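(* The mapping $$T_{ij}(u)\mapsto\sum_{k}S_{k,j-i}(u)\,\omega^{ik}$$ defines an isomorphism of two presentations of the Yangian $Y(\mathfrak{gl}(n))$: the presentation by the generators $T_{ij}^{(m)}$ and the presentation by the principal generators $S_{kl}^{(m)}$. The inverse mapping is given by $$S_{kl}(u)\mapsto\sum_{i}\frac{\omega^{-ki}}{n}\,T_{i+l,i}(u).$$ The sums over $k$ and $i$ run over $\mathbb Z/n\mathbb Z$.
   Context: Let $\omega=e^{2\pi i/n}$ (here $i=\sqrt{-1}$; elsewhere $i$ is an index). All lower indices are read in $\mathbb Z/n\mathbb Z$, and mappings of generating series are understood coefficientwise in $u^{-1}$. First presentation: $Y(\mathfrak{gl}(n))$ is the complex associative unital algebra generated by $T_{ij}^{(m)}$ ($1\le i,j\le n$, $m=1,2,\dots$) subject to $$[T_{ij}^{(l+1)},T_{i'j'}^{(m)}]-[T_{ij}^{(l)},T_{i'j'}^{(m+1)}]=T_{i'j}^{(l)}T_{ij'}^{(m)}-T_{i'j}^{(m)}T_{ij'}^{(l)},\qquad l,m=0,1,2,\dots,$$ with $T_{ij}^{(0)}=\delta_{ij}\cdot1$; put $T_{ij}(u)=\sum_{m\ge0}T_{ij}^{(m)}u^{-m}$ and $T(u)=\sum_{i,j}T_{ij}(u)\otimes E_{ij}$, where $E_{ij}$ are the matrix units acting on $V=\mathbb C^n$. Second (principal) presentation: the generators are the coefficients $S_{kl}^{(m)}$ ($k,l\in\mathbb Z/n\mathbb Z$) of the series $S_{kl}(u)=\sum_{m\ge0}S_{kl}^{(m)}u^{-m}$,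 $S_{kl}^{(0)}=\delta_{k0}\delta_{l0}\cdot1$, introduced by writing $T(u)=\sum_{k,l\in\mathbb Z/n\mathbb Z}S_{kl}(u)\otimes A_{kl}$, where $A_{kl}=\sum_{p\in\mathbb Z/n\mathbb Z}\omega^{kp}E_{p,p+l}$ is the principal basis of $\mathrm{End}(V)$. The relations given for them are, for $i,j,k,l\in\mathbb Z/n\mathbb Z$ and formal variables $u,v$, $$[S_{ij}(u),S_{kl}(v)]=\frac{1}{u-v}\left(\sum_{a,b\in\mathbb Z/n\mathbb Z}\frac{\omega^{ib-bk-ab}}{n}S_{k+a,l+b}(u)S_{i-a,j-b}(v)-\sum_{a,b\in\mathbb Z/n\mathbb Z}\frac{\omega^{ja-al+ab}}{n}S_{k+a,l+b}(v)S_{i-a,j-b}(u)\right).$$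
   Formalization: Corrected: the inverse map uses T_{i,i+l}(u), not T_{i+l,i}(u), which would force T_ij=T_ji; in the S-relations the first sum has S_{i-a,j-b}(u)S_{k+a,l+b}(v) and the second exponent is ja-al-ab; the printed forms fail for every n≥2. *)

theory Defs
  imports
    "HOL-Library.Poly_Mapping"
    "HOL-Algebra.QuotRing"
    "HOL-Algebra.Module"
    "HOL-Algebra.Algebraic_Closure_Type"
    Complex_Main
    "Berlekamp_Zassenhaus.Finite_Field"
begin

section \<open>Complex associative algebras by generators and relations\<close>

text \<open>Lists under concatenation are the free monoid, so finitely supported functions from lists
  to \<^typ>\<open>complex\<close>, with the convolution product of \<^theory>\<open>HOL-Library.Poly_Mapping\<close>,
  form the free associative unital algebra.\<close>

instantiation list :: (type) monoid_add
begin
definition zero_list :: "'a list" where "zero_list = []"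
definition plus_list :: "'a list \<Rightarrow> 'a list \<Rightarrow> 'a list" where "plus_list xs ys = xs @ ys"
instance by standard (simp_all add: zero_list_def plus_list_def)
end

type_synonym 'g free_alg = "'g list \<Rightarrow>\<^sub>0 complex"

definition scalar :: "complex \<Rightarrow> 'g free_alg" where
  "scalar c = Poly_Mapping.single [] c"

definition generator :: "'g \<Rightarrow> 'g free_alg" where
  "generator g = Poly_Mapping.single [g] 1"

definition commutator :: "'a::ring \<Rightarrow> 'a \<Rightarrow> 'a" where
  "commutator x y = x * y - y * x"

abbreviation free_ring :: "'g free_alg ring" where
  "free_ring \<equiv> ring_of_type_algebra"

text \<open>An equation \<open>x = y\<close> between elements of the free algebra is encoded by the relator \<open>x - y\<close>.\<close>

definition relation_ideal :: "'g free_alg set \<Rightarrow> 'g free_alg set" where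
  "relation_ideal R = Idl\<^bsub>free_ring\<^esub> R"

definition residue_class :: "'g free_alg set \<Rightarrow> 'g free_alg \<Rightarrow> 'g free_alg set" where
  "residue_class R x = relation_ideal R +>\<^bsub>free_ring\<^esub> x"

definition presented_algebra :: "'g free_alg set \<Rightarrow> (complex, 'g free_alg set) module" where
  "presented_algebra R =
    (let Q = free_ring Quot (relation_ideal R) in
      \<lparr>carrier = carrier Q, monoid.mult = monoid.mult Q, one = monoid.one Q,
       zero = ring.zero Q, add = ring.add Q,
       module.smult = (\<lambda>c x. residue_class R (scalar c) \<otimes>\<^bsub>Q\<^esub> x)\<rparr>)"

definition alg_hom :: "(complex, 'a) module \<Rightarrow> (complex, 'b) module \<Rightarrow> ('a \<Rightarrow> 'b) set" where
  "alg_hom A B =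
    {\<phi> \<in> Ring.ring_hom A B. \<forall>c. \<forall>x\<in>carrier A. \<phi> (c \<odot>\<^bsub>A\<^esub> x) = c \<odot>\<^bsub>B\<^esub> \<phi> x}"

definition alg_iso :: "(complex, 'a) module \<Rightarrow> (complex, 'b) module \<Rightarrow> ('a \<Rightarrow> 'b) set" where
  "alg_iso A B = {\<phi> \<in> alg_hom A B. bij_betw \<phi> (carrier A) (carrier B)}"

section \<open>The two presentations of the Yangian\<close>

text \<open>Throughout, \<open>n\<close> is \<open>CARD('n)\<close> for an arbitrary finite type \<open>'n\<close>, and \<open>'n mod_ring\<close> is
  \<open>\<int>/n\<int>\<close>; the row and column indices \<open>1, \<dots>, n\<close> are identified with their residues.\<close>

definition omega :: "'n::finite itself \<Rightarrow> complex" where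
  "omega _ = exp (2 * of_real pi * \<i> / of_nat CARD('n))"

definition omega_pow :: "'n::finite mod_ring \<Rightarrow> complex" where
  "omega_pow x = omega TYPE('n) powi (to_int_mod_ring x)"

text \<open>The triple \<open>(i, j, p)\<close> stands for the generator with lower indices \<open>i, j\<close> and upper index
  \<open>p + 1\<close>, since upper index \<open>0\<close> denotes a prescribed scalar and not a generator.\<close>

type_synonym 'n gen = "'n mod_ring \<times> 'n mod_ring \<times> nat"

definition T :: "'n::finite mod_ring \<Rightarrow> 'n mod_ring \<Rightarrow> nat \<Rightarrow> 'n gen free_alg" where
  "T i j m = (case m of 0 \<Rightarrow> (if i = j then 1 else 0) | Suc p \<Rightarrow> generator (i, j, p))"

definition S :: "'n::finite mod_ring \<Rightarrow> 'n mod_ring \<Rightarrow> nat \<Rightarrow> 'n gen free_alg" where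
  "S k l m = (case m of 0 \<Rightarrow> (if k = 0 \<and> l = 0 then 1 else 0) | Suc p \<Rightarrow> generator (k, l, p))"

definition T_relators :: "'n::finite gen free_alg set" where
  "T_relators =
    {commutator (T i j (l + 1)) (T i' j' m) - commutator (T i j l) (T i' j' (m + 1))
      - (T i' j l * T i j' m - T i' j m * T i j' l) | i j i' j' l m. True}"

text \<open>Writing \<open>T(u) = \<Sum> S\<^sub>k\<^sub>l(u) \<otimes> A\<^sub>k\<^sub>l\<close> with \<open>A\<^sub>k\<^sub>l = \<Sum>\<^sub>p \<omega>\<^bsup>kp\<^esup> E\<^bsub>p,p+l\<^esub>\<close> and the flip as
  \<open>P = (1/n) \<Sum>\<^bsub>a,b\<^esub> \<omega>\<^bsup>ab\<^esup> A\<^bsub>a,b\<^esub> \<otimes> A\<^bsub>-a,-b\<^esub>\<close>, the coefficient of \<open>A\<^sub>i\<^sub>j \<otimes> A\<^sub>k\<^sub>l\<close> in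
  \<open>[T\<^sub>1(u), T\<^sub>2(v)] = (P T\<^sub>1(u) T\<^sub>2(v) - T\<^sub>2(v) T\<^sub>1(u) P) / (u - v)\<close> is

  \<open>[S\<^sub>i\<^sub>j(u), S\<^sub>k\<^sub>l(v)] = 1/(u-v)
     (\<Sum>\<^bsub>a,b\<^esub> \<omega>\<^bsup>ib-bk-ab\<^esup>/n S\<^bsub>i-a,j-b\<^esub>(u) S\<^bsub>k+a,l+b\<^esub>(v)
      - \<Sum>\<^bsub>a,b\<^esub> \<omega>\<^bsup>ja-al-ab\<^esup>/n S\<^bsub>k+a,l+b\<^esub>(v) S\<^bsub>i-a,j-b\<^esub>(u))\<close>.

  The relators are the coefficients of \<open>u\<^bsup>-r\<^esup> v\<^bsup>-s\<^esup>\<close> after multiplication by \<open>u - v\<close>; the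
  coefficients with a positive power of \<open>u\<close> or \<open>v\<close> vanish because the constant terms are scalars.

  This corrects three misprints of the source. There, the first sum has
  \<open>S\<^bsub>k+a,l+b\<^esub>(u) S\<^bsub>i-a,j-b\<^esub>(v)\<close> and the second has exponent \<open>ja-al+ab\<close>; neither agrees with the
  defining expansion of \<open>T(u)\<close>. In the inverse map the source has \<open>T\<^bsub>i+l,i\<^esub>(u)\<close> for
  \<open>T\<^bsub>i,i+l\<^esub>(u)\<close>; as printed, its composite with the direct map would send \<open>S\<^sub>k\<^sub>l(u)\<close> to
  \<open>\<omega>\<^bsup>kl\<^esup> S\<^bsub>k,-l\<^esub>(u)\<close>.\<close>

definition S_relators :: "'n::finite gen free_alg set" where
  "S_relators =
    {commutator (S i j (r + 1)) (S k l s) - commutator (S i j r) (S k l (s + 1))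
      - ((\<Sum>a\<in>UNIV. \<Sum>b\<in>UNIV. scalar (omega_pow (i * b - b * k - a * b) / of_nat CARD('n))
            * S (i - a) (j - b) r * S (k + a) (l + b) s)
       - (\<Sum>a\<in>UNIV. \<Sum>b\<in>UNIV. scalar (omega_pow (j * a - a * l - a * b) / of_nat CARD('n))
            * S (k + a) (l + b) s * S (i - a) (j - b) r))
      | i j k l r s. True}"

definition Yangian_T :: "(complex, 'n::finite gen free_alg set) module" where
  "Yangian_T = presented_algebra T_relators"

definition Yangian_S :: "(complex, 'n::finite gen free_alg set) module" where
  "Yangian_S = presented_algebra S_relators"

definition T_class :: "'n::finite gen free_alg \<Rightarrow> 'n gen free_alg set" where
  "T_class = residue_class T_relators"

definition S_class :: "'n::finite gen free_alg \<Rightarrow> 'n gen free_alg set" where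
  "S_class = residue_class S_relators"

end

theory Submission
  imports Defs
begin

text \<open>The change of generators is invertible on the free algebras, by orthogonality of the characters
  of \<open>\<int>/n\<int>\<close>. It exchanges the two ideals of relations: for fixed differences \<open>j\<close> and \<open>l\<close>, the
  \<open>S\<close>-relator at \<open>(i, j, k, l)\<close> is mapped to the two-dimensional finite Fourier transform in
  \<open>(x, y)\<close> of the \<open>T\<close>-relators at \<open>(x, x + j, y, y + l)\<close>, evaluated at \<open>(i, k)\<close>, and Fourier
  inversion gives the converse.\<close>

section \<open>Free algebras\<close>

lemma scalar_0 [simp]: "scalar 0 = 0"
  by (simp add: scalar_def)

lemma single_Nil_1: "Poly_Mapping.single [] 1 = 1"
  unfolding zero_list_def[symmetric] by (rule single_one)

lemma scalar_1 [simp]: "scalar 1 = 1"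
  by (simp add: scalar_def single_Nil_1)

lemma scalar_add: "scalar (c + d) = scalar c + scalar d"
  by (simp add: scalar_def single_add)

lemma scalar_mult: "scalar (c * d) = scalar c * scalar d"
  by (simp add: scalar_def mult_single plus_list_def)

lemma scalar_sum: "scalar (sum f A) = (\<Sum>x\<in>A. scalar (f x))"
  by (induction A rule: infinite_finite_induct) (simp_all add: scalar_add)

lemma single_Cons: "Poly_Mapping.single (g # w) c = generator g * Poly_Mapping.single w c"
  by (simp add: generator_def mult_single plus_list_def)

lemma single_conv_scalar:
  "Poly_Mapping.single w c = scalar c * prod_list (map generator w)"
proof -
  have "Poly_Mapping.single w (1::complex) = prod_list (map generator w)"
    by (induction w) (simp_all add: single_Cons single_Nil_1)
  moreover have "Poly_Mapping.single w c = scalar c * Poly_Mapping.single w 1"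
    by (simp add: scalar_def mult_single plus_list_def)
  ultimately show ?thesis by simp
qed

lemma sum_single_keys:
  "(\<Sum>w\<in>Poly_Mapping.keys p. Poly_Mapping.single w (poly_mapping.lookup p w)) = p"
  by (rule poly_mapping_eqI)
     (auto simp: lookup_sum lookup_single when_def in_keys_iff)

lemma free_alg_linear_induct [case_names zero single add]:
  assumes "P 0" "\<And>w c. P (Poly_Mapping.single w c)" "\<And>x y. P x \<Longrightarrow> P y \<Longrightarrow> P (x + y)"
  shows "P (p :: 'g free_alg)"
proof -
  have "P (\<Sum>w\<in>A. Poly_Mapping.single w (poly_mapping.lookup p w))" for A
    by (induction A rule: infinite_finite_induct) (auto intro: assms)
  from this[of "Poly_Mapping.keys p"] show ?thesis by (simp add: sum_single_keys)
qed

text \<open>Every word is a product of generators, so linear combinations of words are reached from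
  scalars and generators by sums and products. The zero element enters as
  \<open>scalar 0\<close>.\<close>

lemma free_alg_induct [case_names scalar generator add mult]:
  assumes "\<And>c. P (scalar c)" "\<And>g. P (generator g)"
    "\<And>x y. P x \<Longrightarrow> P y \<Longrightarrow> P (x + y)" "\<And>x y. P x \<Longrightarrow> P y \<Longrightarrow> P (x * y)"
  shows "P (p :: 'g free_alg)"
proof (induction p rule: free_alg_linear_induct)
  case zero
  show ?case using assms(1)[of 0] by simp
next
  case (single w c)
  have "P (prod_list (map generator w))"
    using assms(1)[of 1] by (induction w) (auto intro: assms)
  then show ?case by (simp add: single_conv_scalar assms)
qed (rule assms)

text \<open>Scalars sit on the empty word, which commutes with each one-letter word under
  concatenation; centrality then propagates through sums and products.\<close>

lemma scalar_central: "x * scalar c = scalar c * x"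
proof (induction x rule: free_alg_induct)
  case (scalar d)
  show ?case by (simp add: mult.commute flip: scalar_mult)
next
  case (generator g)
  show ?case by (simp add: generator_def scalar_def mult_single plus_list_def)
next
  case (add x y)
  then show ?case by (simp add: distrib_left distrib_right)
next
  case (mult x y)
  have "x * y * scalar c = x * (y * scalar c)" by (rule mult.assoc)
  also have "\<dots> = x * scalar c * y" by (simp only: mult.IH(2) mult.assoc)
  also have "\<dots> = scalar c * (x * y)" by (simp only: mult.IH(1) mult.assoc)
  finally show ?case .
qed

lemma scalar_mult_scalar_mult: "scalar c * x * (scalar d * y) = scalar (c * d) * (x * y)"
proof -
  have "scalar c * x * (scalar d * y) = scalar c * (x * scalar d) * y" by (simp only: mult.assoc)
  then show ?thesis by (simp only: scalar_central[of x d] scalar_mult mult.assoc)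
qed

subsection \<open>Homomorphisms between free algebras\<close>

locale free_alg_hom =
  fixes f :: "'g free_alg \<Rightarrow> 'h free_alg"
  assumes hom_add: "f (x + y) = f x + f y"
    and hom_mult: "f (x * y) = f x * f y"
    and hom_scalar: "f (scalar c) = scalar c"
begin

lemma hom_0: "f 0 = 0"
  using hom_scalar[of 0] by simp

lemma hom_1: "f 1 = 1"
  using hom_scalar[of 1] by simp

lemma hom_diff: "f (x - y) = f x - f y"
  using hom_add[of "x - y" y] by (simp add: algebra_simps)

lemma hom_sum: "f (sum h A) = (\<Sum>x\<in>A. f (h x))"
  by (induction A rule: infinite_finite_induct) (simp_all add: hom_0 hom_add)

lemma hom_commutator: "f (commutator x y) = commutator (f x) (f y)"
  by (simp add: commutator_def hom_diff hom_mult)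

end

lemma free_alg_hom_comp:
  assumes "free_alg_hom f" "free_alg_hom g"
  shows "free_alg_hom (\<lambda>x. f (g x))"
  using assms by (simp add: free_alg_hom_def)

lemma free_alg_hom_id_on_generators:
  assumes "free_alg_hom f" "\<And>g. f (generator g) = generator g"
  shows "f x = x"
  using assms(1) by (induction x rule: free_alg_induct) (simp_all add: free_alg_hom_def assms(2))

text \<open>This realizes the universal property of the free algebra: generators may be sent
  anywhere, and the extension is an algebra homomorphism.\<close>

definition free_extend :: "('g \<Rightarrow> 'h free_alg) \<Rightarrow> 'g free_alg \<Rightarrow> 'h free_alg" where
  "free_extend f p = (\<Sum>w\<in>Poly_Mapping.keys p. scalar (poly_mapping.lookup p w) * prod_list (map f w))"

lemma free_extend_single:
  "free_extend f (Poly_Mapping.single w c) = scalar c * prod_list (map f w)"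
  by (simp add: free_extend_def)

lemma free_extend_generator [simp]: "free_extend f (generator g) = f g"
  by (simp add: generator_def free_extend_single)

lemma free_extend_scalar [simp]: "free_extend f (scalar c) = scalar c"
  by (simp add: free_extend_single scalar_def)

lemma free_extend_add: "free_extend f (p + q) = free_extend f p + free_extend f q"
  unfolding free_extend_def
  \<comment> \<open>Cancellation may make the support of \<open>p + q\<close> smaller than the union
    of the supports. This is harmless because the summand is additive in the coefficient and
    vanishes at coefficient 0.\<close>
  by (rule setsum_keys_plus_distrib) (simp_all add: scalar_add distrib_right)

text \<open>Bilinearity reduces the claim to two words, where concatenation becomes a product and
  central coefficients can be collected in front.\<close>

lemma free_extend_mult: "free_extend f (p * q) = free_extend f p * free_extend f q"
proof (induction p rule: free_alg_linear_induct)
  case (single w c)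
  show ?case
  proof (induction q rule: free_alg_linear_induct)
    case (single v d)
    show ?case
      by (simp add: mult_single free_extend_single plus_list_def scalar_mult_scalar_mult)
  next
    case (add x y)
    then show ?case by (simp add: distrib_left free_extend_add)
  qed (simp add: free_extend_def)
next
  case (add x y)
  then show ?case by (simp add: distrib_right free_extend_add)
qed (simp add: free_extend_def)

lemma free_alg_hom_free_extend: "free_alg_hom (free_extend f)"
  by (simp add: free_alg_hom_def free_extend_add free_extend_mult)

section \<open>Presented algebras\<close>

lemma ring_of_type_algebra_simps [simp]:
  "carrier ring_of_type_algebra = UNIV" "x \<otimes>\<^bsub>ring_of_type_algebra\<^esub> y = x * y"
  "\<one>\<^bsub>ring_of_type_algebra\<^esub> = 1" "\<zero>\<^bsub>ring_of_type_algebra\<^esub> = 0"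
  "x \<oplus>\<^bsub>ring_of_type_algebra\<^esub> y = x + y"
  by (simp_all add: ring_of_type_algebra_def)

text \<open>The library states this for commutative rings only.\<close>

lemma ring_of_type_algebra_ring: "ring (ring_of_type_algebra :: 'a::ring_1 ring)"
proof -
  have "\<exists>y. y + x = 0" for x :: 'a
    using add.left_inverse by blast
  then show ?thesis
    by (intro ringI abelian_groupI monoidI) (auto simp: algebra_simps)
qed

lemma ideal_relation_ideal: "ideal (relation_ideal R) free_ring"
  unfolding relation_ideal_def
  by (rule ring.genideal_ideal[OF ring_of_type_algebra_ring]) simp

lemma relation_ideal_incl: "R \<subseteq> relation_ideal R"
  unfolding relation_ideal_def
  by (rule ring.genideal_self[OF ring_of_type_algebra_ring]) simp

lemma relation_ideal_mult_left: "x \<in> relation_ideal R \<Longrightarrow> y * x \<in> relation_ideal R"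
  using ideal.I_l_closed[OF ideal_relation_ideal, of x R y] by simp

lemma relation_ideal_add:
  "x \<in> relation_ideal R \<Longrightarrow> y \<in> relation_ideal R \<Longrightarrow> x + y \<in> relation_ideal R"
  using additive_subgroup.a_closed[OF ideal.axioms(1)[OF ideal_relation_ideal], of x R y] by simp

lemma relation_ideal_0: "0 \<in> relation_ideal R"
  using additive_subgroup.zero_closed[OF ideal.axioms(1)[OF ideal_relation_ideal], of R] by simp

lemma relation_ideal_sum:
  "(\<And>i. i \<in> A \<Longrightarrow> f i \<in> relation_ideal R) \<Longrightarrow> sum f A \<in> relation_ideal R"
  by (induction A rule: infinite_finite_induct) (auto intro: relation_ideal_0 relation_ideal_add)

lemma residue_class_eq_iff:
  "residue_class R x = residue_class R y \<longleftrightarrow> x - y \<in> relation_ideal R"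
proof -
  have eq: "residue_class R z = (\<lambda>h. h + z) ` relation_ideal R" for z
    by (auto simp: residue_class_def a_r_coset_def')
  have neg: "- h \<in> relation_ideal R" if "h \<in> relation_ideal R" for h
    using relation_ideal_mult_left[OF that, of "- 1"] by simp
  show ?thesis
  proof
    assume "residue_class R x = residue_class R y"
    moreover have "x \<in> residue_class R x"
      using relation_ideal_0 by (force simp: eq)
    ultimately show "x - y \<in> relation_ideal R"
      by (auto simp: eq)
  next
    assume xy: "x - y \<in> relation_ideal R"
    have "h + x \<in> residue_class R y" if "h \<in> relation_ideal R" for h
      using relation_ideal_add[OF that xy] by (force simp: eq)
    moreover have "h + y \<in> residue_class R x" if "h \<in> relation_ideal R" for h
      using relation_ideal_add[OF that neg[OF xy]] by (force simp: eq)
    ultimately show "residue_class R x = residue_class R y"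
      by (auto simp: eq)
  qed
qed

lemma presented_algebra_simps [simp]:
  "carrier (presented_algebra R) = residue_class R ` UNIV"
  "residue_class R x \<otimes>\<^bsub>presented_algebra R\<^esub> residue_class R y = residue_class R (x * y)"
  "residue_class R x \<oplus>\<^bsub>presented_algebra R\<^esub> residue_class R y = residue_class R (x + y)"
  "\<one>\<^bsub>presented_algebra R\<^esub> = residue_class R 1"
  "c \<odot>\<^bsub>presented_algebra R\<^esub> residue_class R x = residue_class R (scalar c * x)"
proof -
  interpret ideal "relation_ideal R" free_ring by (rule ideal_relation_ideal)
  have mult: "residue_class R x \<otimes>\<^bsub>free_ring Quot relation_ideal R\<^esub> residue_class R y
      = residue_class R (x * y)" for x y
    using rcoset_mult_add[of x y] by (simp add: residue_class_def FactRing_def)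
  show "carrier (presented_algebra R) = residue_class R ` UNIV"
    by (auto simp: presented_algebra_def Let_def FactRing_def A_RCOSETS_def'
        residue_class_def a_r_coset_def')
  show "residue_class R x \<otimes>\<^bsub>presented_algebra R\<^esub> residue_class R y = residue_class R (x * y)"
    using mult by (simp add: presented_algebra_def Let_def)
  show "residue_class R x \<oplus>\<^bsub>presented_algebra R\<^esub> residue_class R y = residue_class R (x + y)"
    using a_rcos_sum[of x y] by (simp add: presented_algebra_def Let_def FactRing_def residue_class_def)
  show "\<one>\<^bsub>presented_algebra R\<^esub> = residue_class R 1"
    by (simp add: presented_algebra_def Let_def FactRing_def residue_class_def)
  show "c \<odot>\<^bsub>presented_algebra R\<^esub> residue_class R x = residue_class R (scalar c * x)"
    using mult by (simp add: presented_algebra_def Let_def)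
qed

text \<open>The preimage of a two-sided ideal under a homomorphism is a two-sided ideal. Here it
  contains \<open>R\<close>, hence also the ideal generated by \<open>R\<close>.\<close>

lemma (in free_alg_hom) maps_relation_ideal:
  assumes "\<And>r. r \<in> R \<Longrightarrow> f r \<in> relation_ideal R'" "x \<in> relation_ideal R"
  shows "f x \<in> relation_ideal R'"
proof -
  interpret h: ring_hom_ring free_ring free_ring f
    by (intro ring_hom_ringI2 ring_of_type_algebra_ring ring_hom_memI)
       (simp_all add: hom_add hom_mult hom_1)
  have "ideal {r. f r \<in> relation_ideal R'} free_ring"
    using h.ideal_vimage[OF ideal_relation_ideal, of R'] by simp
  then have "relation_ideal R \<subseteq> {r. f r \<in> relation_ideal R'}"
    unfolding relation_ideal_def[of R] using assms(1)
    by (intro ring.genideal_minimal[OF ring_of_type_algebra_ring]) auto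
  with assms(2) show ?thesis by auto
qed

section \<open>Homomorphisms between presented algebras\<close>

definition induced_map ::
  "'g free_alg set \<Rightarrow> 'h free_alg set \<Rightarrow> ('g free_alg \<Rightarrow> 'h free_alg) \<Rightarrow>
    'g free_alg set \<Rightarrow> 'h free_alg set" where
  "induced_map R R' f C = residue_class R' (f (SOME x. residue_class R x = C))"

context free_alg_hom
begin

text \<open>The arbitrary choice of a representative in \<open>induced_map\<close> does no harm: two
  representatives differ by an element of the ideal, and \<open>f\<close> carries it into the target
  ideal.\<close>

lemma induced_map_residue_class:
  assumes "\<And>r. r \<in> R \<Longrightarrow> f r \<in> relation_ideal R'"
  shows "induced_map R R' f (residue_class R x) = residue_class R' (f x)"
proof -
  have "residue_class R (SOME y. residue_class R y = residue_class R x) = residue_class R x"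
    by (rule someI) (rule refl)
  then have "f ((SOME y. residue_class R y = residue_class R x) - x) \<in> relation_ideal R'"
    by (auto simp: residue_class_eq_iff intro: maps_relation_ideal assms)
  then show ?thesis
    by (simp add: induced_map_def residue_class_eq_iff hom_diff)
qed

lemma induced_map_hom:
  assumes "\<And>r. r \<in> R \<Longrightarrow> f r \<in> relation_ideal R'"
  shows "induced_map R R' f \<in> alg_hom (presented_algebra R) (presented_algebra R')"
  unfolding alg_hom_def
  by (auto intro!: ring_hom_memI
      simp: induced_map_residue_class[OF assms] hom_add hom_mult hom_1 hom_scalar)

end

text \<open>The generators determine a homomorphism out of a presented algebra. This yields the
  uniqueness clauses of the theorem.\<close>

lemma alg_hom_eqI:
  assumes "\<theta> \<in> alg_hom (presented_algebra R) (presented_algebra R')"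
    and "\<phi> \<in> alg_hom (presented_algebra R) (presented_algebra R')"
    and gen: "\<And>g. \<theta> (residue_class R (generator g)) = \<phi> (residue_class R (generator g))"
  shows "\<theta> (residue_class R x) = \<phi> (residue_class R x)"
proof -
  let ?A = "presented_algebra R" and ?B = "presented_algebra R'"
  have *: "\<eta> (residue_class R (scalar c)) = residue_class R' (scalar c)"
    "\<eta> (residue_class R (x + y)) = \<eta> (residue_class R x) \<oplus>\<^bsub>?B\<^esub> \<eta> (residue_class R y)"
    "\<eta> (residue_class R (x * y)) = \<eta> (residue_class R x) \<otimes>\<^bsub>?B\<^esub> \<eta> (residue_class R y)"
    if "\<eta> \<in> alg_hom ?A ?B" for \<eta> c x y
  proof -
    have \<eta>: "\<eta> \<in> Ring.ring_hom ?A ?B"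
      "\<And>c x. \<eta> (c \<odot>\<^bsub>?A\<^esub> residue_class R x) = c \<odot>\<^bsub>?B\<^esub> \<eta> (residue_class R x)"
      using that by (auto simp: alg_hom_def)
    show "\<eta> (residue_class R (scalar c)) = residue_class R' (scalar c)"
      \<comment> \<open>The class of a scalar is that scalar acting on the unit, so compatibility
        with the complex action fixes its image.\<close>
      using \<eta>(2)[of c 1] ring_hom_one[OF \<eta>(1)] by simp
    show "\<eta> (residue_class R (x + y)) = \<eta> (residue_class R x) \<oplus>\<^bsub>?B\<^esub> \<eta> (residue_class R y)"
      using ring_hom_add[OF \<eta>(1), of "residue_class R x" "residue_class R y"] by simp
    show "\<eta> (residue_class R (x * y)) = \<eta> (residue_class R x) \<otimes>\<^bsub>?B\<^esub> \<eta> (residue_class R y)"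
      using ring_hom_mult[OF \<eta>(1), of "residue_class R x" "residue_class R y"] by simp
  qed
  show ?thesis
    by (induction x rule: free_alg_induct) (simp_all add: *[OF assms(1)] *[OF assms(2)] gen)
qed

section \<open>Characters of the cyclic group\<close>

lemma omega_power_card: "omega TYPE('n::finite) ^ CARD('n) = 1"
proof -
  have "omega TYPE('n) ^ CARD('n) = exp (of_nat CARD('n) * (2 * of_real pi * \<i> / of_nat CARD('n)))"
    unfolding omega_def by (rule exp_of_nat_mult[symmetric])
  also have "\<dots> = exp (2 * of_real pi * \<i>)" by simp
  finally show ?thesis by simp
qed

lemma omega_powi_mod: "omega TYPE('n::finite) powi (k mod int CARD('n)) = omega TYPE('n) powi k"
proof -
  have nz: "omega TYPE('n) \<noteq> 0" by (simp add: omega_def)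
  have "omega TYPE('n) powi (int CARD('n) * q + r) = omega TYPE('n) powi r" for q r
    using nz by (simp add: power_int_add power_int_mult omega_power_card)
  from this[of "k div int CARD('n)" "k mod int CARD('n)"] show ?thesis by simp
qed

text \<open>\<open>omega_pow\<close> uses the representative in 0, ..., n-1. Adding representatives
  may wrap around modulo n, which is invisible because \<open>omega\<close> is an n-th root of
  unity.\<close>

lemma omega_pow_add: "omega_pow (x + y) = omega_pow x * omega_pow y"
  for x y :: "'a::finite mod_ring"
proof -
  have "to_int_mod_ring (x + y) = (to_int_mod_ring x + to_int_mod_ring y) mod int CARD('a)"
    by transfer simp
  moreover have "omega TYPE('a) \<noteq> 0" by (simp add: omega_def)
  ultimately show ?thesis
    by (simp add: omega_pow_def omega_powi_mod power_int_add)
qed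

lemma omega_pow_0 [simp]: "omega_pow 0 = 1"
  by (simp add: omega_pow_def)

text \<open>This is the primitivity of \<open>omega\<close>: the points
  \<open>cis (2 * pi * k / n)\<close> are pairwise distinct for k < n, so exponent m can only agree
  with exponent 0 when m = 0.\<close>

lemma omega_pow_eq_1_iff: "omega_pow (x :: 'n::finite mod_ring) = 1 \<longleftrightarrow> x = 0"
proof
  assume 1: "omega_pow x = 1"
  define m where "m = nat (to_int_mod_ring x)"
  have "to_int_mod_ring x \<in> {0..<int CARD('n)}"
    unfolding range_to_int_mod_ring[symmetric] by (rule rangeI)
  then have x: "to_int_mod_ring x = int m" "m < CARD('n)"
    by (auto simp: m_def)
  have "omega_pow x = omega TYPE('n) ^ m"
    by (simp add: omega_pow_def x)
  also have "\<dots> = exp (of_nat m * (2 * of_real pi * \<i> / of_nat CARD('n)))"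
    unfolding omega_def by (rule exp_of_nat_mult[symmetric])
  also have "\<dots> = cis (2 * pi * real m / real CARD('n))"
    by (simp add: cis_conv_exp mult_ac)
  finally have "cis (2 * pi * real m / real CARD('n)) = cis (2 * pi * real 0 / real CARD('n))"
    using 1 by simp
  moreover have "inj_on (\<lambda>k. cis (2 * pi * real k / real CARD('n))) {..<CARD('n)}"
    by (rule bij_betw_imp_inj_on[OF bij_betw_roots_unity]) simp
  ultimately have "m = 0"
    using x(2) inj_onD[of _ _ m 0] by fastforce
  with x(1) show "x = 0"
    by (metis of_int_mod_ring_hom.hom_zero of_int_mod_ring_to_int_mod_ring of_nat_0)
qed simp

text \<open>Shifting \<open>a\<close> by the residue of 1 permutes the summands and multiplies the
  sum by \<open>omega_pow c\<close>. When \<open>c\<close> is nonzero this factor differs from 1, so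
  the sum vanishes.\<close>

lemma sum_omega_pow:
  "(\<Sum>a\<in>UNIV. omega_pow (a * c)) = (if c = 0 then of_nat CARD('n) else 0)"
  for c :: "'n::finite mod_ring"
proof (cases "c = 0")
  case False
  \<comment> \<open>The type \<open>'n\<close> is only assumed finite, whereas the constant
    \<open>1\<close> of \<open>mod_ring\<close> requires at least two elements; the residue of the
    integer 1 works for every n.\<close>
  define u :: "'n mod_ring" where "u = of_int_mod_ring 1"
  have u: "u * c = c"
    unfolding u_def by transfer (auto simp: mod_simps)
  have "omega_pow c * (\<Sum>a\<in>UNIV. omega_pow (a * c)) = (\<Sum>a\<in>UNIV. omega_pow ((a + u) * c))"
    by (simp add: sum_distrib_left omega_pow_add distrib_right u mult.commute[of "omega_pow c"])
  also have "\<dots> = (\<Sum>a\<in>UNIV. omega_pow (a * c))"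
    by (rule sum.reindex_bij_witness[of _ "\<lambda>a. a - u" "\<lambda>a. a + u"]) auto
  finally show ?thesis
    using False omega_pow_eq_1_iff[of c] by simp
qed simp

section \<open>The finite Fourier transform\<close>

lemma scalar_scalar: "scalar c * (scalar d * x) = scalar (c * d) * x"
  by (simp add: scalar_mult mult.assoc)

lemma sum_scalar_mult_sum_scalar:
  "(\<Sum>x\<in>A. scalar (c x) * f x) * (\<Sum>y\<in>B. scalar (d y) * g y)
    = (\<Sum>x\<in>A. \<Sum>y\<in>B. scalar (c x * d y) * (f x * g y))"
  by (simp add: sum_product scalar_mult_scalar_mult)

lemma sum_rotate:
  "(\<Sum>a\<in>A. \<Sum>x\<in>B. \<Sum>y\<in>C. f a x y) = (\<Sum>x\<in>B. \<Sum>y\<in>C. \<Sum>a\<in>A. f a x y)"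
  by (rule trans[OF sum.swap]) (intro sum.cong[OF refl] sum.swap)

text \<open>Orthogonality as a delta function: the sum over \<open>a\<close> removes every
  \<open>x\<close> other than \<open>p\<close> and leaves a factor n. The weight \<open>c\<close>
  carries whatever part of a coefficient is free of \<open>a\<close>.\<close>

lemma sum_character:
  fixes G :: "'n::finite mod_ring \<Rightarrow> 'g free_alg"
  shows "(\<Sum>x\<in>UNIV. \<Sum>a\<in>UNIV. scalar (omega_pow (a * (p - x)) * c x) * G x)
    = scalar (of_nat CARD('n) * c p) * G p"
proof -
  have "(\<Sum>a\<in>UNIV. scalar (omega_pow (a * (p - x)) * c x) * G x)
      = (if x = p then scalar (of_nat CARD('n) * c x) * G x else 0)" for x
    by (simp flip: sum_distrib_right scalar_sum add: sum_omega_pow)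
  then show ?thesis by simp
qed

text \<open>The factor 1/n^2 is the product of the two factors 1/n in the images of two
  \<open>S\<close>-generators. With it, inversion carries no constant.\<close>

definition fourier :: "('n::finite mod_ring \<Rightarrow> 'n mod_ring \<Rightarrow> 'g free_alg) \<Rightarrow>
    'n mod_ring \<Rightarrow> 'n mod_ring \<Rightarrow> 'g free_alg" where
  "fourier G i k =
    (\<Sum>x\<in>UNIV. \<Sum>y\<in>UNIV. scalar (omega_pow (- (i * x + k * y)) / of_nat CARD('n) ^ 2) * G x y)"

lemma fourier_diff: "fourier (\<lambda>x y. G x y - H x y) i k = fourier G i k - fourier H i k"
  by (simp add: fourier_def right_diff_distrib sum_subtractf)

lemma fourier_swap: "fourier (\<lambda>x y. G y x) i k = fourier G k i"
  unfolding fourier_def by (subst sum.swap) (simp add: add.commute)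

lemma fourier_inversion:
  fixes G :: "'n::finite mod_ring \<Rightarrow> 'n mod_ring \<Rightarrow> 'g free_alg"
  shows "(\<Sum>i\<in>UNIV. \<Sum>k\<in>UNIV. scalar (omega_pow (i * p + k * q)) * fourier G i k) = G p q"
proof -
  let ?n = "of_nat CARD('n) :: complex"
  have "(\<Sum>i\<in>UNIV. \<Sum>k\<in>UNIV. scalar (omega_pow (i * p + k * q)) * fourier G i k)
      = (\<Sum>i\<in>UNIV. \<Sum>k\<in>UNIV. \<Sum>x\<in>UNIV. \<Sum>y\<in>UNIV.
          scalar (omega_pow (k * (q - y)) * (omega_pow (i * (p - x)) / ?n ^ 2)) * G x y)"
    by (simp add: fourier_def sum_distrib_left scalar_scalar algebra_simps flip: omega_pow_add)
  \<comment> \<open>Moving the sum over \<open>k\<close> innermost prepares the first use of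
    orthogonality, which forces y = q; the sum over \<open>i\<close> then forces x = p, and the two
    factors n cancel 1/n^2.\<close>
  also have "\<dots> = (\<Sum>i\<in>UNIV. \<Sum>x\<in>UNIV. \<Sum>y\<in>UNIV. \<Sum>k\<in>UNIV.
          scalar (omega_pow (k * (q - y)) * (omega_pow (i * (p - x)) / ?n ^ 2)) * G x y)"
    by (intro sum.cong[OF refl] sum_rotate)
  also have "\<dots> = (\<Sum>i\<in>UNIV. \<Sum>x\<in>UNIV. scalar (?n * (omega_pow (i * (p - x)) / ?n ^ 2)) * G x q)"
    by (intro sum.cong refl, rule sum_character)
  also have "\<dots> = (\<Sum>x\<in>UNIV. \<Sum>i\<in>UNIV. scalar (omega_pow (i * (p - x)) * (1 / ?n)) * G x q)"
    by (subst sum.swap) (simp add: power2_eq_square)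
  also have "\<dots> = scalar (?n * (1 / ?n)) * G p q"
    by (rule sum_character)
  finally show ?thesis by simp
qed

text \<open>Since \<open>a\<close> occurs only in the character, its sum selects b =
  \<open>g x y\<close>. This collapses the quadruple sums produced by the quadratic terms of the
  \<open>S\<close>-relators.\<close>

lemma sum_free_shift:
  fixes F :: "'n::finite mod_ring \<Rightarrow> 'n mod_ring \<Rightarrow> 'n mod_ring \<Rightarrow> 'g free_alg"
  shows "(\<Sum>a\<in>UNIV. \<Sum>b\<in>UNIV. \<Sum>x\<in>UNIV. \<Sum>y\<in>UNIV.
      scalar (omega_pow (a * (g x y - b)) * h b x y) * F b x y)
    = (\<Sum>x\<in>UNIV. \<Sum>y\<in>UNIV. scalar (of_nat CARD('n) * h (g x y) x y) * F (g x y) x y)"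
proof -
  have "(\<Sum>a\<in>UNIV. \<Sum>b\<in>UNIV. \<Sum>x\<in>UNIV. \<Sum>y\<in>UNIV.
      scalar (omega_pow (a * (g x y - b)) * h b x y) * F b x y)
    = (\<Sum>b\<in>UNIV. \<Sum>a\<in>UNIV. \<Sum>x\<in>UNIV. \<Sum>y\<in>UNIV.
      scalar (omega_pow (a * (g x y - b)) * h b x y) * F b x y)"
    by (rule sum.swap)
  also have "\<dots> = (\<Sum>b\<in>UNIV. \<Sum>x\<in>UNIV. \<Sum>y\<in>UNIV. \<Sum>a\<in>UNIV.
      scalar (omega_pow (a * (g x y - b)) * h b x y) * F b x y)"
    by (intro sum.cong[OF refl] sum_rotate)
  also have "\<dots> = (\<Sum>x\<in>UNIV. \<Sum>y\<in>UNIV. \<Sum>b\<in>UNIV. \<Sum>a\<in>UNIV.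
      scalar (omega_pow (a * (g x y - b)) * h b x y) * F b x y)"
    by (rule sum_rotate)
  also have "\<dots> = (\<Sum>x\<in>UNIV. \<Sum>y\<in>UNIV. scalar (of_nat CARD('n) * h (g x y) x y) * F (g x y) x y)"
    by (intro sum.cong refl, rule sum_character)
  finally show ?thesis .
qed

section \<open>The change of generators\<close>

definition S_of_T :: "'n::finite gen free_alg \<Rightarrow> 'n gen free_alg" where
  "S_of_T = free_extend (\<lambda>(i, j, p).
    \<Sum>k\<in>UNIV. scalar (omega_pow (i * k)) * S k (j - i) (Suc p))"

definition T_of_S :: "'n::finite gen free_alg \<Rightarrow> 'n gen free_alg" where
  "T_of_S = free_extend (\<lambda>(k, l, p).
    \<Sum>i\<in>UNIV. scalar (omega_pow (- (k * i)) / of_nat CARD('n)) * T i (i + l) (Suc p))"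

interpretation S_of_T: free_alg_hom S_of_T
  unfolding S_of_T_def by (rule free_alg_hom_free_extend)

interpretation T_of_S: free_alg_hom T_of_S
  unfolding T_of_S_def by (rule free_alg_hom_free_extend)

lemma sum_omega_pow_neg:
  "(\<Sum>a\<in>UNIV. omega_pow (- (c * a))) = (if c = 0 then of_nat CARD('n) else 0)"
  for c :: "'n::finite mod_ring"
  using sum_omega_pow[of "- c"] by (simp add: mult.commute)

text \<open>\<open>S_of_T\<close> is prescribed on generators, that is, for positive upper index. At
  upper index 0 both sides are scalars: only k = 0 survives, and it gives the Kronecker delta of i
  and j.\<close>

lemma S_of_T_T: "S_of_T (T i j m) = (\<Sum>k\<in>UNIV. scalar (omega_pow (i * k)) * S k (j - i) m)"
proof (cases m)
  case 0
  have "(\<Sum>k\<in>UNIV. scalar (omega_pow (i * k)) * S k (j - i) 0)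
      = (\<Sum>k\<in>UNIV. if k = 0 then S k (j - i) 0 else 0)"
    by (intro sum.cong) (auto simp: S_def)
  with 0 show ?thesis
    by (simp add: T_def S_def S_of_T.hom_0 S_of_T.hom_1)
qed (simp add: T_def S_of_T_def)

text \<open>At upper index 0 the shift \<open>l\<close> must be 0, and averaging the character over
  \<open>i\<close> then gives the Kronecker delta of k and 0.\<close>

lemma T_of_S_S: "T_of_S (S k l m) =
    (\<Sum>i\<in>UNIV. scalar (omega_pow (- (k * i)) / of_nat CARD('n)) * T i (i + l) m)"
  for k l :: "'n::finite mod_ring"
proof (cases m)
  case 0
  have "(\<Sum>i\<in>UNIV. scalar (omega_pow (- (k * i)) / of_nat CARD('n)) * T i (i + l) 0)
      = scalar ((\<Sum>i\<in>UNIV. omega_pow (- (k * i))) / of_nat CARD('n)) * (if l = 0 then 1 else 0)"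
    by (simp add: T_def scalar_sum sum_divide_distrib sum_distrib_right)
  with 0 show ?thesis
    by (simp add: S_def sum_omega_pow_neg T_of_S.hom_0 T_of_S.hom_1)
qed (simp add: S_def T_of_S_def)

lemma S_of_T_T_of_S: "S_of_T (T_of_S x) = x"
proof (rule free_alg_hom_id_on_generators)
  show "free_alg_hom (\<lambda>x. S_of_T (T_of_S x))"
    by (rule free_alg_hom_comp; unfold_locales)
next
  fix g :: "'a gen"
  obtain k l p where g: "g = (k, l, p)" by (cases g)
  let ?n = "of_nat CARD('a) :: complex"
  have "S_of_T (T_of_S (S k l (Suc p))) =
      (\<Sum>i\<in>UNIV. \<Sum>k'\<in>UNIV. scalar (omega_pow (i * (k' - k)) * (1 / ?n)) * S k' l (Suc p))"
  proof -
    have "omega_pow (- (k * i)) / ?n * omega_pow (i * k') = omega_pow (i * (k' - k)) * (1 / ?n)"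
      for i k'
      by (simp add: right_diff_distrib mult.commute flip: omega_pow_add)
    then show ?thesis
      by (simp only: T_of_S_S S_of_T.hom_sum S_of_T.hom_mult S_of_T.hom_scalar S_of_T_T
          sum_distrib_left scalar_scalar add_diff_cancel_left')
  qed
  \<comment> \<open>Replacing \<open>i\<close> by its negative reverses the sign of the exponent,
    giving the form that \<open>sum_character\<close> expects.\<close>
  also have "\<dots> = (\<Sum>k'\<in>UNIV. \<Sum>i\<in>UNIV. scalar (omega_pow (i * (k - k')) * (1 / ?n)) * S k' l (Suc p))"
  proof -
    have "(\<Sum>i\<in>UNIV. scalar (omega_pow (i * (k' - k)) * (1 / ?n)) * S k' l (Suc p))
      = (\<Sum>i\<in>UNIV. scalar (omega_pow (i * (k - k')) * (1 / ?n)) * S k' l (Suc p))" for k'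
      by (rule sum.reindex_bij_witness[of _ uminus uminus]) (auto simp: algebra_simps)
    then show ?thesis by (subst sum.swap) simp
  qed
  also have "\<dots> = scalar (?n * (1 / ?n)) * S k l (Suc p)"
    by (rule sum_character)
  finally show "S_of_T (T_of_S (generator g)) = generator g"
    by (simp add: g S_def)
qed

lemma T_of_S_S_of_T: "T_of_S (S_of_T x) = x"
proof (rule free_alg_hom_id_on_generators)
  show "free_alg_hom (\<lambda>x. T_of_S (S_of_T x))"
    by (rule free_alg_hom_comp; unfold_locales)
next
  fix g :: "'a gen"
  obtain i j p where g: "g = (i, j, p)" by (cases g)
  let ?n = "of_nat CARD('a) :: complex"
  have "T_of_S (S_of_T (T i j (Suc p))) =
      (\<Sum>k\<in>UNIV. \<Sum>x\<in>UNIV. scalar (omega_pow (k * (i - x)) * (1 / ?n)) * T x (x + (j - i)) (Suc p))"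
  proof -
    have "omega_pow (i * k) * (omega_pow (- (k * x)) / ?n) = omega_pow (k * (i - x)) * (1 / ?n)"
      for k x
      by (simp add: right_diff_distrib mult.commute flip: omega_pow_add)
    then show ?thesis
      by (simp only: T_of_S_S T_of_S.hom_sum T_of_S.hom_mult T_of_S.hom_scalar S_of_T_T
          sum_distrib_left scalar_scalar)
  qed
  also have "\<dots> = scalar (?n * (1 / ?n)) * T i (i + (j - i)) (Suc p)"
    by (subst sum.swap) (rule sum_character)
  finally show "T_of_S (S_of_T (generator g)) = generator g"
    by (simp add: g T_def)
qed

section \<open>Relators under the change of generators\<close>

definition T_relator where
  "T_relator i j i' j' l m =
    commutator (T i j (l + 1)) (T i' j' m) - commutator (T i j l) (T i' j' (m + 1))
      - (T i' j l * T i j' m - T i' j m * T i j' l)"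

definition S_relator where
  "S_relator i j k l r s =
    commutator (S i j (r + 1)) (S k l s) - commutator (S i j r) (S k l (s + 1))
      - ((\<Sum>a\<in>UNIV. \<Sum>b\<in>UNIV. scalar (omega_pow (i * b - b * k - a * b) / of_nat CARD('n))
            * S (i - a) (j - b) r * S (k + a) (l + b) s)
       - (\<Sum>a\<in>UNIV. \<Sum>b\<in>UNIV. scalar (omega_pow (j * a - a * l - a * b) / of_nat CARD('n))
            * S (k + a) (l + b) s * S (i - a) (j - b) r))"
  for i j k l :: "'n::finite mod_ring"

lemma T_relators_eq: "T_relators = {T_relator i j i' j' l m | i j i' j' l m. True}"
  by (simp only: T_relators_def T_relator_def)

lemma S_relators_eq: "S_relators = {S_relator i j k l r s | i j k l r s. True}"
  by (simp only: S_relators_def S_relator_def)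

lemma T_of_S_S_mult_S:
  "T_of_S (S i j r) * T_of_S (S k l s) = fourier (\<lambda>x y. T x (x + j) r * T y (y + l) s) i k"
  by (simp add: T_of_S_S sum_scalar_mult_sum_scalar fourier_def power2_eq_square flip: omega_pow_add)

lemma T_of_S_commutator:
  "T_of_S (commutator (S i j r) (S k l s))
    = fourier (\<lambda>x y. commutator (T x (x + j) r) (T y (y + l) s)) i k"
proof -
  \<comment> \<open>The reversed product is a transform evaluated at (k, i); renaming the summation
    variables brings it to the point (i, k) of the other product.\<close>
  have swapped: "T_of_S (S k l s) * T_of_S (S i j r) = fourier (\<lambda>x y. T y (y + l) s * T x (x + j) r) i k"
    unfolding T_of_S_S_mult_S by (rule fourier_swap)
  show ?thesis
    unfolding T_of_S.hom_commutator
    by (simp only: commutator_def fourier_diff swapped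
        T_of_S_S_mult_S[of i j r k l s])
qed

text \<open>The total exponent is split into a part \<open>d\<close>, to be taken as the multiple of
  the summation variable \<open>a\<close>, and a remainder \<open>e''\<close>. The prefactor 1/n of
  a quadratic term and the 1/n^2 of a transform combine to 1/n^3; summing over \<open>a\<close>
  later restores one factor n.\<close>

lemma omega_pow_coefficient:
  fixes d e e' e'' :: "'n::finite mod_ring"
  assumes "e + e' = d + e''"
  shows "omega_pow e / of_nat CARD('n) * (omega_pow e' / of_nat CARD('n) ^ 2)
    = omega_pow d * (omega_pow e'' / of_nat CARD('n) ^ 3)"
  using assms
  by (simp add: power2_eq_square power3_eq_cube mult.assoc flip: omega_pow_add)

lemma card_coefficient:
  "of_nat CARD('n::finite) * (c / of_nat CARD('n) ^ 3) = (c :: complex) / of_nat CARD('n) ^ 2"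
  by (simp add: power2_eq_square power3_eq_cube)

text \<open>Summing over \<open>a\<close> forces \<open>b = x - y\<close> in the first sum and \<open>b = j - l + x - y\<close> in the
  second one.\<close>

lemma T_of_S_first_sum:
  fixes i j k l :: "'n::finite mod_ring"
  shows "T_of_S (\<Sum>a\<in>UNIV. \<Sum>b\<in>UNIV. scalar (omega_pow (i * b - b * k - a * b) / of_nat CARD('n))
            * S (i - a) (j - b) r * S (k + a) (l + b) s)
    = fourier (\<lambda>x y. T y (x + j) r * T x (y + l) s) i k"
proof -
  let ?n = "of_nat CARD('n) :: complex"
  have "T_of_S (\<Sum>a\<in>UNIV. \<Sum>b\<in>UNIV. scalar (omega_pow (i * b - b * k - a * b) / ?n)
            * S (i - a) (j - b) r * S (k + a) (l + b) s)
    = (\<Sum>a\<in>UNIV. \<Sum>b\<in>UNIV. scalar (omega_pow (i * b - b * k - a * b) / ?n)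
        * fourier (\<lambda>x y. T x (x + (j - b)) r * T y (y + (l + b)) s) (i - a) (k + a))"
    by (simp add: T_of_S.hom_sum T_of_S.hom_mult T_of_S.hom_scalar mult.assoc T_of_S_S_mult_S)
  also have "\<dots> = (\<Sum>a\<in>UNIV. \<Sum>b\<in>UNIV. \<Sum>x\<in>UNIV. \<Sum>y\<in>UNIV.
      scalar (omega_pow (a * ((x - y) - b)) * (omega_pow (i * b - b * k - i * x - k * y) / ?n ^ 3))
        * (T x (x + (j - b)) r * T y (y + (l + b)) s))"
  proof -
    have "(i * b - b * k - a * b) + - ((i - a) * x + (k + a) * y)
        = a * ((x - y) - b) + (i * b - b * k - i * x - k * y)" for a b x y
      by (simp add: algebra_simps)
    note coefficient = omega_pow_coefficient[OF this]
    show ?thesis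
      by (simp only: fourier_def sum_distrib_left scalar_scalar coefficient)
  qed
  also have "\<dots> = (\<Sum>x\<in>UNIV. \<Sum>y\<in>UNIV.
      scalar (?n * (omega_pow (i * (x - y) - (x - y) * k - i * x - k * y) / ?n ^ 3))
        * (T x (x + (j - (x - y))) r * T y (y + (l + (x - y))) s))"
    by (rule sum_free_shift)
  \<comment> \<open>With b = x - y the column indices x + j - b and y + l + b become y + j and x +
    l, and the exponent becomes -(k * x + i * y). The variables have thus traded roles, which
    \<open>fourier_swap\<close> undoes.\<close>
  also have "\<dots> = fourier (\<lambda>x y. T x (y + j) r * T y (x + l) s) k i"
  proof -
    have "i * (x - y) - (x - y) * k - i * x - k * y = - (k * x + i * y)"
      "x + (j - (x - y)) = y + j" "y + (l + (x - y)) = x + l" for x y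
      by (simp_all add: algebra_simps)
    then show ?thesis
      by (simp only: fourier_def card_coefficient)
  qed
  also have "\<dots> = fourier (\<lambda>x y. T y (x + j) r * T x (y + l) s) i k"
    by (rule fourier_swap)
  finally show ?thesis .
qed

lemma T_of_S_second_sum:
  fixes i j k l :: "'n::finite mod_ring"
  shows "T_of_S (\<Sum>a\<in>UNIV. \<Sum>b\<in>UNIV. scalar (omega_pow (j * a - a * l - a * b) / of_nat CARD('n))
            * S (k + a) (l + b) s * S (i - a) (j - b) r)
    = fourier (\<lambda>x y. T y (x + j) s * T x (y + l) r) i k"
proof -
  let ?n = "of_nat CARD('n) :: complex"
  have "T_of_S (\<Sum>a\<in>UNIV. \<Sum>b\<in>UNIV. scalar (omega_pow (j * a - a * l - a * b) / ?n)
            * S (k + a) (l + b) s * S (i - a) (j - b) r)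
    = (\<Sum>a\<in>UNIV. \<Sum>b\<in>UNIV. scalar (omega_pow (j * a - a * l - a * b) / ?n)
        * fourier (\<lambda>y x. T y (y + (l + b)) s * T x (x + (j - b)) r) (k + a) (i - a))"
    by (simp add: T_of_S.hom_sum T_of_S.hom_mult T_of_S.hom_scalar mult.assoc T_of_S_S_mult_S)
  also have "\<dots> = (\<Sum>a\<in>UNIV. \<Sum>b\<in>UNIV. \<Sum>y\<in>UNIV. \<Sum>x\<in>UNIV.
      scalar (omega_pow (a * ((j - l + x - y) - b)) * (omega_pow (- (i * x + k * y)) / ?n ^ 3))
        * (T y (y + (l + b)) s * T x (x + (j - b)) r))"
  proof -
    have "(j * a - a * l - a * b) + - ((k + a) * y + (i - a) * x)
        = a * ((j - l + x - y) - b) + (- (i * x + k * y))" for a b x y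
      by (simp add: algebra_simps)
    note coefficient = omega_pow_coefficient[OF this]
    show ?thesis
      by (simp only: fourier_def sum_distrib_left scalar_scalar coefficient)
  qed
  also have "\<dots> = (\<Sum>y\<in>UNIV. \<Sum>x\<in>UNIV.
      scalar (?n * (omega_pow (- (i * x + k * y)) / ?n ^ 3))
        * (T y (y + (l + (j - l + x - y))) s * T x (x + (j - (j - l + x - y))) r))"
    by (rule sum_free_shift)
  \<comment> \<open>With b = j - l + x - y the columns become x + j and y + l in the exchanged
    order. The remaining exponent contains no \<open>b\<close> and is unchanged; the outer variable
    \<open>y\<close> belongs to \<open>k\<close>, hence the evaluation at (k, i).\<close>
  also have "\<dots> = fourier (\<lambda>y x. T y (x + j) s * T x (y + l) r) k i"
  proof -
    have "i * x + k * y = k * y + i * x"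
      "y + (l + (j - l + x - y)) = x + j" "x + (j - (j - l + x - y)) = y + l" for x y
      by (simp_all add: algebra_simps)
    then show ?thesis
      by (simp only: fourier_def card_coefficient)
  qed
  also have "\<dots> = fourier (\<lambda>x y. T y (x + j) s * T x (y + l) r) i k"
    by (rule fourier_swap)
  finally show ?thesis .
qed

text \<open>All four terms are transforms at the same point (i, k), so linearity assembles them into
  the transform of one \<open>T\<close>-relator.\<close>

lemma T_of_S_S_relator:
  "T_of_S (S_relator i j k l r s) = fourier (\<lambda>x y. T_relator x (x + j) y (y + l) r s) i k"
  unfolding S_relator_def T_relator_def
  by (simp only: T_of_S.hom_diff T_of_S_commutator T_of_S_first_sum T_of_S_second_sum fourier_diff)

text \<open>No second computation is made: Fourier inversion writes the \<open>T\<close>-relator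
  through images under \<open>T_of_S\<close>, and applying \<open>S_of_T\<close> cancels that
  map.\<close>

lemma S_of_T_T_relator:
  "S_of_T (T_relator p p' q q' r s) = (\<Sum>i\<in>UNIV. \<Sum>k\<in>UNIV.
    scalar (omega_pow (i * p + k * q)) * S_relator i (p' - p) k (q' - q) r s)"
proof -
  \<comment> \<open>Writing each column as its row plus a difference puts arbitrary indices into the
    form covered by the transform.\<close>
  have "T_relator p p' q q' r s = T_relator p (p + (p' - p)) q (q + (q' - q)) r s"
    by simp
  also have "\<dots> = (\<Sum>i\<in>UNIV. \<Sum>k\<in>UNIV. scalar (omega_pow (i * p + k * q)) *
      T_of_S (S_relator i (p' - p) k (q' - q) r s))"
    unfolding T_of_S_S_relator by (rule fourier_inversion[symmetric])
  finally show ?thesis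
    by (simp add: S_of_T.hom_sum S_of_T.hom_mult S_of_T.hom_scalar S_of_T_T_of_S)
qed

section \<open>Passage to the two Yangian presentations\<close>

lemma S_of_T_relators:
  fixes t :: "'a::finite gen free_alg"
  shows "t \<in> T_relators \<Longrightarrow> S_of_T t \<in> relation_ideal S_relators"
proof -
  have "S_relator i j k l r s \<in> relation_ideal S_relators" for i j k l :: "'a mod_ring" and r s
    by (rule subsetD[OF relation_ideal_incl]) (unfold S_relators_eq, blast)
  then show "t \<in> T_relators \<Longrightarrow> S_of_T t \<in> relation_ideal S_relators"
    by (auto simp: T_relators_eq S_of_T_T_relator
        intro!: relation_ideal_sum relation_ideal_mult_left)
qed

lemma T_of_S_relators:
  fixes t :: "'a::finite gen free_alg"
  shows "t \<in> S_relators \<Longrightarrow> T_of_S t \<in> relation_ideal T_relators"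
proof -
  have "T_relator i j i' j' l m \<in> relation_ideal T_relators"
    for i j i' j' :: "'a mod_ring" and l m
    by (rule subsetD[OF relation_ideal_incl]) (unfold T_relators_eq, blast)
  then show "t \<in> S_relators \<Longrightarrow> T_of_S t \<in> relation_ideal T_relators"
    by (auto simp: S_relators_eq T_of_S_S_relator fourier_def
        intro!: relation_ideal_sum relation_ideal_mult_left)
qed

theorem theorem3p5:
  shows "\<exists>(\<phi> :: 'n::finite gen free_alg set \<Rightarrow> 'n gen free_alg set) \<psi>.
    \<phi> \<in> alg_iso Yangian_T Yangian_S \<and>
    (\<forall>i j m. \<phi> (T_class (T i j m)) =
      S_class (\<Sum>k\<in>UNIV. scalar (omega_pow (i * k)) * S k (j - i) m)) \<and>
    (\<forall>\<theta> \<in> alg_hom Yangian_T Yangian_S.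
      (\<forall>i j m. \<theta> (T_class (T i j m)) = \<phi> (T_class (T i j m))) \<longrightarrow>
      (\<forall>x \<in> carrier Yangian_T. \<theta> x = \<phi> x)) \<and>
    \<psi> \<in> alg_iso Yangian_S Yangian_T \<and>
    (\<forall>k l m. \<psi> (S_class (S k l m)) =
      T_class (\<Sum>i\<in>UNIV. scalar (omega_pow (- (k * i)) / of_nat CARD('n)) * T i (i + l) m)) \<and>
    (\<forall>\<theta> \<in> alg_hom Yangian_S Yangian_T.
      (\<forall>k l m. \<theta> (S_class (S k l m)) = \<psi> (S_class (S k l m))) \<longrightarrow>
      (\<forall>y \<in> carrier Yangian_S. \<theta> y = \<psi> y)) \<and>
    (\<forall>x \<in> carrier Yangian_T. \<psi> (\<phi> x) = x) \<and>
    (\<forall>y \<in> carrier Yangian_S. \<phi> (\<psi> y) = y)"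
proof -
  define \<phi> :: "'n gen free_alg set \<Rightarrow> 'n gen free_alg set"
    where "\<phi> = induced_map T_relators S_relators S_of_T"
  define \<psi> :: "'n gen free_alg set \<Rightarrow> 'n gen free_alg set"
    where "\<psi> = induced_map S_relators T_relators T_of_S"
  note defs = T_class_def S_class_def Yangian_T_def Yangian_S_def
  have \<phi>_class: "\<phi> (T_class x) = S_class (S_of_T x)" for x
    unfolding \<phi>_def defs by (rule S_of_T.induced_map_residue_class) (rule S_of_T_relators)
  have \<psi>_class: "\<psi> (S_class x) = T_class (T_of_S x)" for x
    unfolding \<psi>_def defs by (rule T_of_S.induced_map_residue_class) (rule T_of_S_relators)
  have carrier: "carrier Yangian_T = range T_class" "carrier Yangian_S = range S_class"
    unfolding defs by simp_all
  have \<phi>_hom: "\<phi> \<in> alg_hom Yangian_T Yangian_S"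
    unfolding \<phi>_def defs by (rule S_of_T.induced_map_hom) (rule S_of_T_relators)
  have \<psi>_hom: "\<psi> \<in> alg_hom Yangian_S Yangian_T"
    unfolding \<psi>_def defs by (rule T_of_S.induced_map_hom) (rule T_of_S_relators)
  have \<psi>\<phi>: "\<forall>x \<in> carrier Yangian_T. \<psi> (\<phi> x) = x"
    by (auto simp: carrier \<phi>_class \<psi>_class T_of_S_S_of_T)
  have \<phi>\<psi>: "\<forall>y \<in> carrier Yangian_S. \<phi> (\<psi> y) = y"
    by (auto simp: carrier \<phi>_class \<psi>_class S_of_T_T_of_S)
  \<comment> \<open>Bijectivity comes from the mutually inverse maps on the free algebras, which
    remain mutually inverse on residue classes.\<close>
  have "bij_betw \<phi> (carrier Yangian_T) (carrier Yangian_S)"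
    by (rule bij_betw_byWitness[OF \<psi>\<phi> \<phi>\<psi>]) (auto simp: carrier \<phi>_class \<psi>_class)
  with \<phi>_hom have \<phi>_iso: "\<phi> \<in> alg_iso Yangian_T Yangian_S"
    by (simp add: alg_iso_def)
  have "bij_betw \<psi> (carrier Yangian_S) (carrier Yangian_T)"
    by (rule bij_betw_byWitness[OF \<phi>\<psi> \<psi>\<phi>]) (auto simp: carrier \<phi>_class \<psi>_class)
  with \<psi>_hom have \<psi>_iso: "\<psi> \<in> alg_iso Yangian_S Yangian_T"
    by (simp add: alg_iso_def)
  \<comment> \<open>The series coefficients with upper index \<open>Suc p\<close> already exhaust
    the free generators, so agreement on all coefficients gives the hypothesis of
    \<open>alg_hom_eqI\<close>.\<close>
  have gen: "generator g = T (fst g) (fst (snd g)) (Suc (snd (snd g)))"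
    "generator g = S (fst g) (fst (snd g)) (Suc (snd (snd g)))" for g :: "'n gen"
    by (simp_all add: T_def S_def)
  have \<phi>_unique: "\<theta> x = \<phi> x"
    if "\<theta> \<in> alg_hom Yangian_T Yangian_S"
      and "\<forall>i j m. \<theta> (T_class (T i j m)) = \<phi> (T_class (T i j m))"
      and "x \<in> carrier Yangian_T" for \<theta> x
  proof -
    have "\<theta> (T_class z) = \<phi> (T_class z)" for z
      unfolding T_class_def
      by (rule alg_hom_eqI[OF that(1)[unfolded defs] \<phi>_hom[unfolded defs]])
         (simp only: gen(1) that(2) flip: T_class_def)
    with that(3) show ?thesis by (auto simp: carrier)
  qed
  have \<psi>_unique: "\<theta> y = \<psi> y"
    if "\<theta> \<in> alg_hom Yangian_S Yangian_T"
      and "\<forall>k l m. \<theta> (S_class (S k l m)) = \<psi> (S_class (S k l m))"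
      and "y \<in> carrier Yangian_S" for \<theta> y
  proof -
    have "\<theta> (S_class z) = \<psi> (S_class z)" for z
      unfolding S_class_def
      by (rule alg_hom_eqI[OF that(1)[unfolded defs] \<psi>_hom[unfolded defs]])
         (simp only: gen(2) that(2) flip: S_class_def)
    with that(3) show ?thesis by (auto simp: carrier)
  qed
  have \<phi>_gen: "\<forall>i j m. \<phi> (T_class (T i j m)) =
      S_class (\<Sum>k\<in>UNIV. scalar (omega_pow (i * k)) * S k (j - i) m)"
    by (simp add: \<phi>_class S_of_T_T)
  have \<psi>_gen: "\<forall>k l m. \<psi> (S_class (S k l m)) =
      T_class (\<Sum>i\<in>UNIV. scalar (omega_pow (- (k * i)) / of_nat CARD('n)) * T i (i + l) m)"
    by (simp add: \<psi>_class T_of_S_S)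
  show ?thesis
    by (rule exI[of _ \<phi>], rule exI[of _ \<psi>], intro conjI ballI impI)
       (rule \<phi>_iso \<phi>_gen \<psi>_iso \<psi>_gen bspec[OF \<psi>\<phi>] bspec[OF \<phi>\<psi>]
         \<phi>_unique \<psi>_unique; assumption)+
qed

end
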